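(* The elliptic function $d$ has a pole at $\frac{2}{3} i K'$.
   Context: Fix $0 < k < 1$. Let $u = \int_0^{\sin \phi} F(\frac{1}{3}, \frac{2}{3} ; \frac{1}{2} ; k^2 t^2) \, \frac{{\rm d} t}{\sqrt{1 - t^2}}$, where $F = {}_2F_1$ is the Gauss hypergeometric function; near the origin this inverts to $u \mapsto \phi(u)$ with $\phi(0)=0$, and $d(u) = \phi'(u) = 1/F(\frac{1}{3}, \frac{2}{3} ; \frac{1}{2} ; k^2 \sin^2 \phi(u))$. The function $d$ extends to the elliptic function $d = 1 - \frac{4}{9} k^2 (\wp + \frac{1}{3})^{-1}$, where $\wp$ is the Weierstrass function with invariants $g_2 = \frac{4}{27}(9 - 8k^2)$ and $g_3 = \frac{8}{27^2}(8k^4 - 36k^2 + 27)$. Since $0<k<1$, $\wp$ has real invariants and positive discriminant, so its period lattice is rectangular; $2K$ and $2 i K'$ (with $K > 0$, $K' > 0$) denote fundamental periods of $\wp$ (and hence of $d$). *)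

theory Defs
  imports "HOL-Complex_Analysis.Complex_Analysis"
begin

definition period_lattice :: "complex \<Rightarrow> complex \<Rightarrow> complex set" where
  "period_lattice w1 w2 = {of_int m * w1 + of_int n * w2 | m n :: int. True}"

text \<open>Weierstrass elliptic function of the lattice generated by w1, w2
  (the sum is absolutely convergent off the lattice).\<close>
definition weierstrass_p :: "complex \<Rightarrow> complex \<Rightarrow> complex \<Rightarrow> complex" where
  "weierstrass_p w1 w2 z =
     1 / z ^ 2 + infsum (\<lambda>w. 1 / (z - w) ^ 2 - 1 / w ^ 2) (period_lattice w1 w2 - {0})"

definition eisenstein_G :: "nat \<Rightarrow> complex \<Rightarrow> complex \<Rightarrow> complex" where
  "eisenstein_G k w1 w2 = infsum (\<lambda>w. 1 / w ^ k) (period_lattice w1 w2 - {0})"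

definition invariant_g2 :: "complex \<Rightarrow> complex \<Rightarrow> complex" where
  "invariant_g2 w1 w2 = 60 * eisenstein_G 4 w1 w2"

definition invariant_g3 :: "complex \<Rightarrow> complex \<Rightarrow> complex" where
  "invariant_g3 w1 w2 = 140 * eisenstein_G 6 w1 w2"

end

(* At z0 = 2iK'/3, a third of a period, the function wp satisfies 12 wp wp'^2 = wp''^2.
   Together with the differential equations for wp'^2 and wp'' this says that wp(z0) is a root
   of the 3-division polynomial, and for the given g2, g3 this polynomial has the root -1/3.
   To single out -1/3: on the imaginary axis wp is real and wp' is purely imaginary, so wp'^2 <= 0,
   and the relation forces wp(z0) <= 0, whereas no other root is real and <= 0.
   Moreover wp'(z0) is nonzero because the discriminant is, so wp + 1/3 has a simple zero. *)
theory Submission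
  imports Defs
begin

text \<open>The relation at a third of a period is the duplication formula
  \<open>wp (2 z) = (wp'' / wp')^2 / 4 - 2 wp\<close> in disguise: \<open>2 z0\<close> and
  \<open>- z0\<close> differ by a period and \<open>wp\<close> is even, so
  \<open>3 wp = (wp'' / wp')^2 / 4\<close> at \<open>z0\<close>. The proof avoids addition theorems.
  Everything about \<open>wp\<close> has to come out of the lattice sums that define it and its
  invariants, and one tool recurs: an elliptic function that has a finite limit at 0 and no poles
  off the lattice is constant. To apply it, the principal part and the coefficients at
  \<open>z^2\<close> and \<open>z^4\<close>, which carry \<open>g2\<close> and \<open>g3\<close>,
  are split off, leaving \<open>z^6\<close> times a function holomorphic at 0. The differential
  equations use the tool on the lattice of \<open>wp\<close>; the relation uses it on the finer
  lattice generated by \<open>w1\<close> and \<open>w2 / 3\<close>. Symmetry of the lattice under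
  conjugation turns the resulting complex identities into real ones, where signs can be
  compared.\<close>

text \<open>Half of the exponent 3: a product of two such factors will dominate the inverse cubes
  over a planar lattice, and \<open>3/2 > 1\<close> gives convergence.\<close>

lemma summable_on_int_powr:
  "(\<lambda>m::int. (1 + \<bar>of_int m\<bar>) powr (-3/2) :: real) summable_on UNIV"
proof -
  define g :: "int \<Rightarrow> real" where "g = (\<lambda>m. (1 + \<bar>of_int m\<bar>) powr (-3/2))"
  have "summable (\<lambda>n. real n powr (-3/2))"
    by (simp add: summable_real_powr_iff)
  then have s1: "summable (\<lambda>n. real (Suc n) powr (-3/2))" and s2: "summable (\<lambda>n. real (Suc (Suc n)) powr (-3/2))"
    using summable_Suc_iff[of "\<lambda>n. real n powr (-3/2)"] summable_Suc_iff[of "\<lambda>n. real (Suc n) powr (-3/2)"]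
    by blast+
  have "(\<lambda>n::nat. g (int n)) summable_on UNIV"
    by (rule norm_summable_imp_summable_on) (use s1 in \<open>simp add: g_def\<close>)
  then have a: "g summable_on range int"
    by (subst summable_on_reindex) (auto simp: o_def inj_on_def)
  \<comment> \<open>The negative integers, enumerated as \<open>- n - 1\<close> so that 0 is not
    counted twice.\<close>
  have "(\<lambda>n::nat. g (- int n - 1)) summable_on UNIV"
  proof (rule norm_summable_imp_summable_on)
    have "norm (g (- int n - 1)) = real (Suc (Suc n)) powr (-3/2)" for n
      by (simp add: g_def abs_if)
    then show "summable (\<lambda>n. norm (g (- int n - 1)))" using s2 by simp
  qed
  then have b: "g summable_on range (\<lambda>n::nat. - int n - 1)"
    by (subst summable_on_reindex) (auto simp: o_def inj_on_def)
  have "g summable_on (range int \<union> range (\<lambda>n::nat. - int n - 1))"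
    by (rule summable_on_Un_disjoint[OF a b]) auto
  moreover have "range int \<union> range (\<lambda>n::nat. - int n - 1) = UNIV"
  proof -
    have "m \<in> range int \<union> range (\<lambda>n::nat. - int n - 1)" for m :: int
    proof (cases "m \<ge> 0")
      case True
      then have "m = int (nat m)" by simp
      then show ?thesis by blast
    next
      case False
      then have "m = - int (nat (- m - 1)) - 1" by simp
      then show ?thesis by blast
    qed
    then show ?thesis by blast
  qed
  ultimately show ?thesis by (simp add: g_def)
qed

text \<open>Weierstrass M-test: the majorant makes the finite partial sums converge uniformly, and
  uniform limits of holomorphic functions are holomorphic.\<close>

lemma holomorphic_on_infsum:
  fixes f :: "'a \<Rightarrow> complex \<Rightarrow> complex"
  assumes "open A"
    and "\<And>w. w \<in> X \<Longrightarrow> f w holomorphic_on A"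
    and "\<And>w z. w \<in> X \<Longrightarrow> z \<in> A \<Longrightarrow> norm (f w z) \<le> M w"
    and "M summable_on X"
  shows "(\<lambda>z. \<Sum>\<^sub>\<infinity>w\<in>X. f w z) holomorphic_on A"
proof -
  have "(\<lambda>z. \<Sum>\<^sub>\<infinity>w\<in>X. f w z) analytic_on A"
    unfolding analytic_on_def
  proof
    fix z assume "z \<in> A"
    then obtain e where e: "e > 0" "cball z e \<subseteq> A"
      using \<open>open A\<close> open_contains_cball by blast
    have ul: "uniform_limit (cball z e) (\<lambda>F z. \<Sum>w\<in>F. f w z) (\<lambda>z. \<Sum>\<^sub>\<infinity>w\<in>X. f w z) (finite_subsets_at_top X)"
      by (rule Weierstrass_m_test_general[OF _ assms(4)]) (use assms(3) e in auto)
    have ev: "\<forall>\<^sub>F F in finite_subsets_at_top X. continuous_on (cball z e) (\<lambda>z. \<Sum>w\<in>F. f w z) \<and>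
        (\<lambda>z. \<Sum>w\<in>F. f w z) holomorphic_on ball z e"
    proof (rule eventually_finite_subsets_at_top_weakI)
      fix F assume F: "finite F" "F \<subseteq> X"
      have "(\<lambda>z. \<Sum>w\<in>F. f w z) holomorphic_on cball z e"
        using F e assms(2) by (intro holomorphic_on_sum) (meson holomorphic_on_subset subsetD)
      then show "continuous_on (cball z e) (\<lambda>z. \<Sum>w\<in>F. f w z) \<and>
          (\<lambda>z. \<Sum>w\<in>F. f w z) holomorphic_on ball z e"
        by (meson ball_subset_cball holomorphic_on_imp_continuous_on holomorphic_on_subset)
    qed
    have "(\<lambda>z. \<Sum>\<^sub>\<infinity>w\<in>X. f w z) holomorphic_on ball z e"
      by (rule holomorphic_uniform_limit[OF ev ul]) auto
    then show "\<exists>e>0. (\<lambda>z. \<Sum>\<^sub>\<infinity>w\<in>X. f w z) holomorphic_on ball z e"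
      using e by blast
  qed
  then show ?thesis by (rule analytic_imp_holomorphic)
qed

section \<open>Lattices and absolute convergence of lattice sums\<close>

text \<open>Up to sign, \<open>Im (w1 * cnj w2)\<close> is the area of a period parallelogram, so
  this is linear independence over the reals without a choice of orientation.\<close>

locale complex_lattice =
  fixes w1 w2 :: complex
  assumes indep: "Im (w1 * cnj w2) \<noteq> 0"
begin

abbreviation L :: "complex set" where "L \<equiv> period_lattice w1 w2"

lemma lattice_memI [intro]: "of_int m * w1 + of_int n * w2 \<in> L"
  unfolding period_lattice_def by blast

lemma lattice_add: "x \<in> L \<Longrightarrow> y \<in> L \<Longrightarrow> x + y \<in> L"
  unfolding period_lattice_def
proof clarify
  fix m n m' n' :: int
  have "of_int m * w1 + of_int n * w2 + (of_int m' * w1 + of_int n' * w2)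
      = of_int (m + m') * w1 + of_int (n + n') * w2"
    by (simp add: algebra_simps)
  then show "\<exists>ma na. of_int m * w1 + of_int n * w2 + (of_int m' * w1 + of_int n' * w2)
      = of_int ma * w1 + of_int na * w2 \<and> True"
    by blast
qed

lemma lattice_uminus: "x \<in> L \<Longrightarrow> - x \<in> L"
  unfolding period_lattice_def
proof clarify
  fix m n :: int
  have "- (of_int m * w1 + of_int n * w2) = of_int (- m) * w1 + of_int (- n) * w2"
    by (simp add: algebra_simps)
  then show "\<exists>ma na. - (of_int m * w1 + of_int n * w2) = of_int ma * w1 + of_int na * w2 \<and> True"
    by blast
qed

lemma lattice_uminus_iff [simp]: "- x \<in> L \<longleftrightarrow> x \<in> L"
  using lattice_uminus[of x] lattice_uminus[of "- x"] by auto

lemma lattice_diff: "x \<in> L \<Longrightarrow> y \<in> L \<Longrightarrow> x - y \<in> L"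
  using lattice_add[of x "- y"] by simp

lemma lattice_add_iff: "y \<in> L \<Longrightarrow> x + y \<in> L \<longleftrightarrow> x \<in> L"
  using lattice_add[of x y] lattice_diff[of "x + y" y] by auto

lemma zero_in_lattice [simp]: "0 \<in> L"
  using lattice_memI[of 0 0] by simp

lemma w1_in_lattice [simp]: "w1 \<in> L"
  using lattice_memI[of 1 0] by simp

lemma w2_in_lattice [simp]: "w2 \<in> L"
  using lattice_memI[of 0 1] by simp

text \<open>Cramer's rule: multiplying by \<open>cnj w2\<close> or \<open>cnj w1\<close> and taking
  imaginary parts isolates one coordinate up to the factor \<open>D\<close>. Uniqueness of
  coordinates, discreteness of the lattice and convergence of its sums rest on this bound.\<close>

lemma coordinate_bound:
  obtains c where "c > 0" "\<And>s t :: real. c * (\<bar>s\<bar> + \<bar>t\<bar>) \<le> norm (of_real s * w1 + of_real t * w2)"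
proof -
  define D where "D = Im (w1 * cnj w2)"
  have D: "\<bar>D\<bar> > 0" using indep D_def by simp
  have nz: "w1 \<noteq> 0" "w2 \<noteq> 0" using indep by auto
  define N where "N = norm w1 + norm w2"
  have N: "N > 0" using nz by (simp add: N_def add_pos_pos)
  have "\<bar>D\<bar> / N * (\<bar>s\<bar> + \<bar>t\<bar>) \<le> norm (of_real s * w1 + of_real t * w2)" for s t :: real
  proof -
    let ?z = "of_real s * w1 + of_real t * w2"
    have "s * D = Im (?z * cnj w2)" "- t * D = Im (?z * cnj w1)"
      by (simp_all add: D_def algebra_simps)
    then have "\<bar>s\<bar> * \<bar>D\<bar> \<le> norm ?z * norm w2" "\<bar>t\<bar> * \<bar>D\<bar> \<le> norm ?z * norm w1"
      by (metis abs_Im_le_cmod abs_mult complex_mod_cnj norm_mult abs_minus)+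
    then have "\<bar>D\<bar> * (\<bar>s\<bar> + \<bar>t\<bar>) \<le> norm ?z * N"
      by (simp add: N_def algebra_simps)
    then show ?thesis
      using N by (simp add: field_simps)
  qed
  then show ?thesis using that[of "\<bar>D\<bar> / N"] D N by simp
qed

lemma coordinates_exist:
  obtains s t :: real where "z = of_real s * w1 + of_real t * w2"
proof -
  define D where "D = Im (w1 * cnj w2)"
  have D: "D \<noteq> 0" using indep D_def by simp
  have "of_real D * z = of_real (Im (z * cnj w2)) * w1 + of_real (- Im (z * cnj w1)) * w2"
    by (simp add: D_def complex_eq_iff algebra_simps)
  moreover have "z = of_real D * z / of_real D" using D by simp
  ultimately have "z = (of_real (Im (z * cnj w2)) * w1 + of_real (- Im (z * cnj w1)) * w2) / of_real D"
    by argo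
  also have "\<dots> = of_real (Im (z * cnj w2) / D) * w1 + of_real (- Im (z * cnj w1) / D) * w2"
    by (simp only: add_divide_distrib of_real_divide times_divide_eq_left)
  finally have "z = of_real (Im (z * cnj w2) / D) * w1 + of_real (- Im (z * cnj w1) / D) * w2" .
  then show ?thesis using that by blast
qed

lemma coordinates_unique:
  fixes s t s' t' :: real
  assumes "of_real s * w1 + of_real t * w2 = of_real s' * w1 + of_real t' * w2"
  shows "s = s'" "t = t'"
proof -
  obtain c where c: "c > 0" "\<And>s t :: real. c * (\<bar>s\<bar> + \<bar>t\<bar>) \<le> norm (of_real s * w1 + of_real t * w2)"
    using coordinate_bound by blast
  have "of_real (s - s') * w1 + of_real (t - t') * w2 = 0"
    using assms by (simp add: algebra_simps)
  then have "c * (\<bar>s - s'\<bar> + \<bar>t - t'\<bar>) \<le> 0"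
    using c(2)[of "s - s'" "t - t'"] by simp
  then have "\<bar>s - s'\<bar> + \<bar>t - t'\<bar> \<le> 0"
    using c(1) by (simp add: mult_le_0_iff)
  then show "s = s'" "t = t'" by linarith+
qed

lemma lattice_as_image: "L = (\<lambda>(m::int, n::int). of_int m * w1 + of_int n * w2) ` UNIV"
  by (auto simp: period_lattice_def)

lemma inj_lattice_coordinates: "inj (\<lambda>(m::int, n::int). of_int m * w1 + of_int n * w2)"
proof (rule injI, clarify)
  fix m n m' n' :: int
  assume "of_int m * w1 + of_int n * w2 = of_int m' * w1 + of_int n' * w2"
  then have "of_real (of_int m) * w1 + of_real (of_int n) * w2
      = of_real (of_int m') * w1 + of_real (of_int n') * w2" by simp
  from coordinates_unique[OF this] show "m = m' \<and> n = n'" by simp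
qed

lemma finite_lattice_cball: "finite {w \<in> L. norm w \<le> R}"
proof -
  obtain c where c: "c > 0" "\<And>s t :: real. c * (\<bar>s\<bar> + \<bar>t\<bar>) \<le> norm (of_real s * w1 + of_real t * w2)"
    using coordinate_bound by blast
  define N where "N = \<lceil>R / c\<rceil>"
  have "{w \<in> L. norm w \<le> R} \<subseteq> (\<lambda>(m, n). of_int m * w1 + of_int n * w2) ` ({-N..N} \<times> {-N..N})"
  proof
    fix w assume w: "w \<in> {w \<in> L. norm w \<le> R}"
    then obtain m n :: int where mn: "w = of_int m * w1 + of_int n * w2"
      by (auto simp: period_lattice_def)
    have "c * (\<bar>of_int m\<bar> + \<bar>of_int n\<bar>) \<le> R"
      using c(2)[of "of_int m" "of_int n"] w mn by simp
    then have "\<bar>of_int m\<bar> + \<bar>of_int n\<bar> \<le> R / c"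
      using c(1) by (simp add: field_simps)
    then have "\<bar>of_int m\<bar> \<le> (of_int N :: real)" "\<bar>of_int n\<bar> \<le> (of_int N :: real)"
      unfolding N_def by linarith+
    then have "m \<in> {-N..N}" "n \<in> {-N..N}" by auto
    then show "w \<in> (\<lambda>(m, n). of_int m * w1 + of_int n * w2) ` ({-N..N} \<times> {-N..N})"
      using mn by auto
  qed
  then show ?thesis by (rule finite_subset) auto
qed

lemma lattice_norm_bound:
  obtains e where "e > 0" "\<And>w. w \<in> L - {0} \<Longrightarrow> e \<le> norm w"
proof -
  obtain c where c: "c > 0" "\<And>s t :: real. c * (\<bar>s\<bar> + \<bar>t\<bar>) \<le> norm (of_real s * w1 + of_real t * w2)"
    using coordinate_bound by blast
  have "c \<le> norm w" if w: "w \<in> L - {0}" for w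
  proof -
    obtain m n :: int where mn: "w = of_int m * w1 + of_int n * w2"
      using w by (auto simp: period_lattice_def)
    then have "m \<noteq> 0 \<or> n \<noteq> 0" using w by auto
    then have "1 \<le> \<bar>real_of_int m\<bar> + \<bar>real_of_int n\<bar>" by linarith
    then have "c * 1 \<le> c * (\<bar>real_of_int m\<bar> + \<bar>real_of_int n\<bar>)"
      using c(1) by (intro mult_left_mono) auto
    then show ?thesis using c(2)[of "of_int m" "of_int n"] mn by simp
  qed
  then show ?thesis using that c(1) by blast
qed

lemma closed_subset_lattice:
  assumes "S \<subseteq> L"
  shows "closed S"
proof -
  obtain e where e: "e > 0" "\<And>w. w \<in> L - {0} \<Longrightarrow> e \<le> norm w" using lattice_norm_bound by blast
  show ?thesis
  proof (rule discrete_imp_closed[OF e(1)], intro ballI impI)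
    fix x y assume "x \<in> S" "y \<in> S" "dist y x < e"
    then show "y = x"
      using assms e(2)[of "y - x"] lattice_diff[of y x] by (force simp: dist_norm)
  qed
qed

lemma open_compl_lattice: "open (- L)"
  using closed_subset_lattice[of L] by (simp add: open_closed)

lemma open_compl_lattice_nz: "open (- (L - {0}))"
  using closed_subset_lattice[of "L - {0}"] open_Compl by blast

lemma lattice_isolated_0:
  obtains d where "d > 0" "ball 0 d \<subseteq> - (L - {0})"
  using open_compl_lattice_nz open_contains_ball[of "- (L - {0})"] by auto

text \<open>In coordinates the terms are dominated by a product \<open>g m * g n\<close>, which is
  summable because each factor is.\<close>

lemma summable_inverse_cubes: "(\<lambda>w. 1 / norm w ^ 3) summable_on L"
proof -
  obtain c where c: "c > 0" "\<And>s t :: real. c * (\<bar>s\<bar> + \<bar>t\<bar>) \<le> norm (of_real s * w1 + of_real t * w2)"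
    using coordinate_bound by blast
  define g :: "int \<Rightarrow> real" where "g = (\<lambda>m. (1 + \<bar>of_int m\<bar>) powr (-3/2))"
  have g: "g summable_on UNIV" using summable_on_int_powr by (simp add: g_def)
  have "(\<lambda>(m, n). g m * g n) summable_on (UNIV \<times> UNIV)"
  proof (rule summable_on_SigmaI)
    show "((\<lambda>n. case (m, n) of (m, n) \<Rightarrow> g m * g n) has_sum g m * infsum g UNIV) UNIV" for m
      using has_sum_cmult_right[OF has_sum_infsum[OF g]] by simp
    show "(\<lambda>m. g m * infsum g UNIV) summable_on UNIV"
      using summable_on_cmult_left[OF g] by simp
  qed (auto simp: g_def)
  then have G: "(\<lambda>(m, n). 27 / c ^ 3 * (g m * g n)) summable_on UNIV"
    using summable_on_cmult_right[of "\<lambda>(m, n). g m * g n" UNIV "27 / c ^ 3"]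
    by (simp add: case_prod_unfold)
  have "(\<lambda>(m::int, n::int). norm (1 / norm (of_int m * w1 + of_int n * w2) ^ 3)) summable_on UNIV"
  proof -
    have "(\<lambda>p. norm ((\<lambda>(m::int, n::int). 1 / norm (of_int m * w1 + of_int n * w2) ^ 3) p)) summable_on UNIV"
    proof (rule Infinite_Sum.abs_summable_on_comparison_test'[OF G], clarify)
      fix m n :: int
      define a b :: real where "a = \<bar>of_int m\<bar>" and "b = \<bar>of_int n\<bar>"
      have ab: "a \<ge> 0" "b \<ge> 0" by (auto simp: a_def b_def)
      show "norm (1 / norm (of_int m * w1 + of_int n * w2) ^ 3) \<le> 27 / c ^ 3 * (g m * g n)"
      proof (cases "m = 0 \<and> n = 0")
        \<comment> \<open>The origin may be included in the sum because
          \<open>1 / 0 = 0\<close>.\<close>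
        case True
        then show ?thesis using c(1) by (simp add: g_def)
      next
        case False
        then have "a \<ge> 1 \<or> b \<ge> 1" by (auto simp: a_def b_def)
        then have ab1: "a + b \<ge> 1" using ab by auto
        have le: "c * (a + b) \<le> norm (of_int m * w1 + of_int n * w2)"
          using c(2)[of "of_int m" "of_int n"] by (simp add: a_def b_def)
        \<comment> \<open>Each factor is at most \<open>3 * (a + b)\<close> since
          \<open>a + b \<ge> 1\<close>. The power \<open>3/2\<close> turns the square into a cube
          and produces the constant 27.\<close>
        have "(1 + a) * (1 + b) \<le> (3 * (a + b)) * (3 * (a + b))"
          using ab ab1 by (intro mult_mono) auto
        then have "(1 + a) * (1 + b) \<le> (3 * (a + b)) powr 2"
          using ab1 by (simp add: power2_eq_square)
        then have "((1 + a) * (1 + b)) powr (3/2) \<le> ((3 * (a + b)) powr 2) powr (3/2)"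
          using ab by (intro powr_mono2) auto
        also have "\<dots> = (3 * (a + b)) ^ 3"
          using ab1 by (simp only: powr_powr) simp
        also have "\<dots> = 27 * (a + b) ^ 3"
          by (simp only: power_mult_distrib) simp
        finally have 1: "((1 + a) * (1 + b)) powr (3/2) \<le> 27 * (a + b) ^ 3" .
        have pos: "0 < c * (a + b)" using c(1) ab1 by simp
        then have "0 < norm (of_int m * w1 + of_int n * w2)" using le by linarith
        then have pos: "0 < norm (of_int m * w1 + of_int n * w2) ^ 3 * (c * (a + b)) ^ 3" "0 \<le> c * (a + b)"
          using pos by (auto intro!: mult_pos_pos)
        have "1 / norm (of_int m * w1 + of_int n * w2) ^ 3 \<le> 1 / (c * (a + b)) ^ 3"
          using pos by (intro divide_left_mono power_mono le) auto
        also have "\<dots> = 27 / c ^ 3 * (1 / (27 * (a + b) ^ 3))"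
          using c(1) ab1 by (simp add: power_mult_distrib)
        also have "\<dots> \<le> 27 / c ^ 3 * (1 / ((1 + a) * (1 + b)) powr (3/2))"
          using 1 ab ab1 c(1) by (intro mult_left_mono divide_left_mono mult_pos_pos) auto
        also have "1 / ((1 + a) * (1 + b)) powr (3/2) = g m * g n"
          using ab by (simp add: g_def powr_mult powr_minus_divide flip: a_def b_def)
        finally show ?thesis by simp
      qed
    qed
    then show ?thesis by (simp add: case_prod_unfold)
  qed
  then have "((\<lambda>w. 1 / norm w ^ 3) \<circ> (\<lambda>(m::int, n::int). of_int m * w1 + of_int n * w2)) summable_on UNIV"
    by (simp add: o_def case_prod_unfold)
  then show ?thesis
    unfolding lattice_as_image using summable_on_reindex[OF inj_lattice_coordinates] by blast
qed

lemma summable_inverse_powers_norm: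
  assumes "k \<ge> 3"
  shows "(\<lambda>w. 1 / norm w ^ k) summable_on (L - {0})"
proof -
  obtain e where e: "e > 0" "\<And>w. w \<in> L - {0} \<Longrightarrow> e \<le> norm w" using lattice_norm_bound by blast
  have s: "(\<lambda>w. 1 / e ^ (k - 3) * (1 / norm w ^ 3)) summable_on (L - {0})"
    by (intro summable_on_cmult_right summable_on_subset_banach[OF summable_inverse_cubes]) auto
  have "(\<lambda>w. norm (1 / norm w ^ k)) summable_on (L - {0})"
  proof (rule Infinite_Sum.abs_summable_on_comparison_test'[OF s])
    fix w assume w: "w \<in> L - {0}"
    have "norm w ^ k = norm w ^ (k - 3) * norm w ^ 3"
      using assms by (simp flip: power_add)
    moreover have "1 / norm w ^ (k - 3) \<le> 1 / e ^ (k - 3)"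
      using e(1) e(2)[OF w] w by (intro divide_left_mono power_mono mult_pos_pos zero_less_power) auto
    ultimately show "norm (1 / norm w ^ k) \<le> 1 / e ^ (k - 3) * (1 / norm w ^ 3)"
      using mult_right_mono[of "1 / norm w ^ (k - 3)" "1 / e ^ (k - 3)" "1 / norm w ^ 3"] by simp
  qed
  then show ?thesis by simp
qed

lemma summable_inverse_powers:
  assumes "k \<ge> 3"
  shows "(\<lambda>w. 1 / w ^ k) summable_on (L - {0})"
  by (rule abs_summable_summable) (use summable_inverse_powers_norm[OF assms] in \<open>simp add: norm_divide norm_power\<close>)

text \<open>The terms at \<open>w\<close> and \<open>- w\<close> cancel. This removes the odd
  coefficients from the Laurent expansion of \<open>wp\<close>.\<close>

lemma eisenstein_odd:
  assumes "odd k"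
  shows "eisenstein_G k w1 w2 = 0"
proof -
  have "eisenstein_G k w1 w2 = infsum (\<lambda>w. - (1 / w ^ k)) (L - {0})"
    unfolding eisenstein_G_def
    by (rule infsum_reindex_bij_witness[where i = uminus and j = uminus]) (use assms in auto)
  also have "\<dots> = - eisenstein_G k w1 w2"
    unfolding eisenstein_G_def by (rule infsum_uminus)
  finally show ?thesis by simp
qed


section \<open>Laurent expansion at 0, evenness and periodicity of \<open>wp\<close>\<close>

abbreviation wp :: "complex \<Rightarrow> complex" where "wp \<equiv> weierstrass_p w1 w2"

text \<open>The remainder of the expansion \<open>1/(z-w)\<^sup>2 - 1/w\<^sup>2 = (\<Sum>n\<ge>1. (n+1) z\<^sup>n / w\<^bsup>n+2\<^esup>)\<close>
  after its fifth term, divided by \<open>z\<^sup>6\<close>.\<close>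
definition tail_term :: "complex \<Rightarrow> complex \<Rightarrow> complex" where
  "tail_term w z = (7 * w - 6 * z) / (w ^ 7 * (w - z) ^ 2)"

definition wp_tail :: "complex \<Rightarrow> complex" where
  "wp_tail z = (\<Sum>\<^sub>\<infinity>w\<in>L - {0}. tail_term w z)"

text \<open>The numerator is at most \<open>10 * norm w\<close> and \<open>norm (w - z)\<close> is
  at least half of \<open>norm w\<close>; squaring the latter costs a factor 4, hence 40.\<close>

lemma norm_tail_term_le:
  assumes "0 < norm w" "2 * norm z \<le> norm w"
  shows "norm (tail_term w z) \<le> 40 * (1 / norm w ^ 8)"
proof -
  have "norm (7 * w - 6 * z) \<le> norm (7 * w) + norm (6 * z)" by (rule norm_triangle_ineq4)
  then have 1: "norm (7 * w - 6 * z) \<le> 10 * norm w" using assms(2) by simp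
  have "norm w / 2 \<le> norm w - norm z" using assms(2) by simp
  also have "\<dots> \<le> norm (w - z)" by (rule norm_triangle_ineq2)
  finally have "(norm w / 2) ^ 2 \<le> norm (w - z) ^ 2" by (intro power_mono) auto
  then have 2: "norm w ^ 7 * (norm w / 2) ^ 2 \<le> norm w ^ 7 * norm (w - z) ^ 2"
    by (intro mult_left_mono) auto
  have "norm (tail_term w z) = norm (7 * w - 6 * z) / (norm w ^ 7 * norm (w - z) ^ 2)"
    by (simp add: tail_term_def norm_divide norm_mult norm_power)
  also have "\<dots> \<le> 10 * norm w / (norm w ^ 7 * (norm w / 2) ^ 2)"
    by (rule frac_le[OF _ 1 _ 2]) (use assms in auto)
  also have "norm w ^ 7 * (norm w / 2) ^ 2 = norm w * (norm w ^ 8 / 4)"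
    by (simp add: eval_nat_numeral)
  also have "10 * norm w / (norm w * (norm w ^ 8 / 4)) = 40 * (1 / norm w ^ 8)"
    using assms(1) by simp
  finally show ?thesis .
qed

text \<open>Only finitely many lattice points have norm at most \<open>2 * R\<close>. All others are
  at least twice as large as any \<open>z\<close> in the ball, so their terms have a majorant
  independent of \<open>z\<close>.\<close>

lemma summable_and_holomorphic_tail_ball:
  assumes "R > 0"
  defines "U \<equiv> ball 0 R \<inter> - (L - {0})"
  shows "\<And>z. z \<in> U \<Longrightarrow> (\<lambda>w. tail_term w z) summable_on (L - {0})"
    and "wp_tail holomorphic_on U"
proof -
  define F where "F = {w \<in> L. norm w \<le> 2 * R} - {0}"
  define X where "X = {w \<in> L. norm w > 2 * R}"
  have FX: "L - {0} = F \<union> X" "F \<inter> X = {}" using assms(1) by (auto simp: F_def X_def)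
  have finF: "finite F" unfolding F_def using finite_lattice_cball by blast
  have M: "(\<lambda>w. 40 * (1 / norm w ^ 8)) summable_on X"
    by (intro summable_on_cmult_right summable_on_subset_banach[OF summable_inverse_powers_norm])
       (use FX in auto)
  have bnd: "norm (tail_term w z) \<le> 40 * (1 / norm w ^ 8)" if "w \<in> X" "z \<in> U" for w z
    by (rule norm_tail_term_le) (use that assms(1) in \<open>auto simp: X_def U_def\<close>)
  have sX: "(\<lambda>w. tail_term w z) summable_on X" if "z \<in> U" for z
    by (rule abs_summable_summable, rule Infinite_Sum.abs_summable_on_comparison_test'[OF M])
       (rule bnd[OF _ that])
  have sF: "(\<lambda>w. tail_term w z) summable_on F" for z
    using finF by (rule summable_on_finite)
  show "(\<lambda>w. tail_term w z) summable_on (L - {0})" if "z \<in> U" for z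
    using summable_on_Un_disjoint[OF sF sX[OF that] FX(2)] by (simp only: FX(1))
  have opU: "open U" unfolding U_def by (intro open_Int open_ball open_compl_lattice_nz)
  have hol: "tail_term w holomorphic_on U" if "w \<in> L - {0}" for w
    unfolding tail_term_def by (intro holomorphic_intros) (use that in \<open>auto simp: U_def\<close>)
  have "(\<lambda>z. \<Sum>\<^sub>\<infinity>w\<in>X. tail_term w z) holomorphic_on U"
    by (rule holomorphic_on_infsum[OF opU hol bnd M]) (use FX(1) in blast)
  moreover have "(\<lambda>z. \<Sum>w\<in>F. tail_term w z) holomorphic_on U"
    by (rule holomorphic_on_sum, rule hol) (simp add: FX(1))
  ultimately have "(\<lambda>z. (\<Sum>w\<in>F. tail_term w z) + (\<Sum>\<^sub>\<infinity>w\<in>X. tail_term w z)) holomorphic_on U"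
    by (rule holomorphic_on_add[rotated])
  then show "wp_tail holomorphic_on U"
  proof (rule holomorphic_transform)
    fix z assume z: "z \<in> U"
    show "(\<Sum>w\<in>F. tail_term w z) + (\<Sum>\<^sub>\<infinity>w\<in>X. tail_term w z) = wp_tail z"
      using infsum_Un_disjoint[OF sF sX[OF z] FX(2)] finF by (simp add: wp_tail_def FX(1)[symmetric])
  qed
qed

lemma summable_tail: "z \<notin> L - {0} \<Longrightarrow> (\<lambda>w. tail_term w z) summable_on (L - {0})"
  using summable_and_holomorphic_tail_ball(1)[of "norm z + 1" z]
  by (auto simp: add_nonneg_pos)

lemma holomorphic_wp_tail: "wp_tail holomorphic_on - (L - {0})"
proof -
  have "wp_tail analytic_on - (L - {0})"
  proof (subst analytic_on_analytic_at, rule ballI)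
    fix z assume z: "z \<in> - (L - {0})"
    have R: "norm z + 1 > 0" by (simp add: add_nonneg_pos)
    have "open (ball 0 (norm z + 1) \<inter> - (L - {0}))"
      by (intro open_Int open_ball open_compl_lattice_nz)
    moreover have "z \<in> ball 0 (norm z + 1) \<inter> - (L - {0})" using z by auto
    ultimately show "wp_tail analytic_on {z}"
      using summable_and_holomorphic_tail_ball(2)[OF R] analytic_at by blast
  qed
  then show ?thesis by (rule analytic_imp_holomorphic)
qed

lemma wp_term_expansion:
  assumes "w \<noteq> 0" "z \<noteq> w"
  shows "1 / (z - w) ^ 2 - 1 / w ^ 2 =
    2 * z * (1 / w ^ 3) + 3 * z ^ 2 * (1 / w ^ 4) + 4 * z ^ 3 * (1 / w ^ 5)
    + 5 * z ^ 4 * (1 / w ^ 6) + 6 * z ^ 5 * (1 / w ^ 7) + z ^ 6 * tail_term w z"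
proof -
  define t where "t = z / w"
  have z: "z = w * t" using assms(1) by (simp add: t_def)
  have t: "1 - t \<noteq> 0" using assms by (auto simp: t_def)
  define S where "S = 1 + 2 * t + 3 * t ^ 2 + 4 * t ^ 3 + 5 * t ^ 4 + 6 * t ^ 5"
  \<comment> \<open>\<open>S\<close> is the series of \<open>1 / (1 - t)^2\<close> cut after
    \<open>t^5\<close>; multiplied by \<open>(1 - t)^2\<close> it misses 1 by exactly
    \<open>7 t^6 - 6 t^7\<close>, the source of the numerator of \<open>tail_term\<close>.\<close>
  have key: "S * (1 - t) ^ 2 + t ^ 6 * (7 - 6 * t) = 1"
    unfolding S_def by algebra
  have zw: "(z - w) ^ 2 = w ^ 2 * (1 - t) ^ 2" "(w - z) ^ 2 = w ^ 2 * (1 - t) ^ 2"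
    unfolding z by algebra+
  have "1 / (z - w) ^ 2 = (S * (1 - t) ^ 2 + t ^ 6 * (7 - 6 * t)) / (w ^ 2 * (1 - t) ^ 2)"
    unfolding key zw ..
  also have "\<dots> = S / w ^ 2 + t ^ 6 * (7 - 6 * t) / (w ^ 2 * (1 - t) ^ 2)"
    using t by (simp add: add_divide_distrib)
  also have "t ^ 6 * (7 - 6 * t) / (w ^ 2 * (1 - t) ^ 2) = z ^ 6 * tail_term w z"
  proof -
    have "z ^ 6 * (7 * w - 6 * z) = w ^ 7 * (t ^ 6 * (7 - 6 * t))" unfolding z by algebra
    then have "z ^ 6 * tail_term w z = w ^ 7 * (t ^ 6 * (7 - 6 * t)) / (w ^ 7 * (w ^ 2 * (1 - t) ^ 2))"
      by (simp only: tail_term_def zw times_divide_eq_right)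
    also have "\<dots> = t ^ 6 * (7 - 6 * t) / (w ^ 2 * (1 - t) ^ 2)"
      by (rule mult_divide_mult_cancel_left) (use assms(1) in simp)
    finally show ?thesis ..
  qed
  also have "S / w ^ 2 = 1 / w ^ 2 + 2 * z * (1 / w ^ 3) + 3 * z ^ 2 * (1 / w ^ 4) + 4 * z ^ 3 * (1 / w ^ 5)
    + 5 * z ^ 4 * (1 / w ^ 6) + 6 * z ^ 5 * (1 / w ^ 7)"
    using assms(1) by (simp add: S_def z add_divide_distrib power_mult_distrib eval_nat_numeral)
  finally show ?thesis by simp
qed

text \<open>The expansion of a single term is summed over the lattice coefficient by coefficient.
  Being a \<open>has_sum\<close> statement, it also provides the convergence of the series that
  defines \<open>wp\<close>.\<close>

lemma wp_terms_has_sum: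
  assumes "z \<notin> L"
  shows "((\<lambda>w. 1 / (z - w) ^ 2 - 1 / w ^ 2) has_sum
    (3 * eisenstein_G 4 w1 w2 * z ^ 2 + 5 * eisenstein_G 6 w1 w2 * z ^ 4 + z ^ 6 * wp_tail z)) (L - {0})"
proof -
  have G: "((\<lambda>w. 1 / w ^ k) has_sum eisenstein_G k w1 w2) (L - {0})" if "k \<ge> 3" for k
    unfolding eisenstein_G_def by (intro has_sum_infsum summable_inverse_powers that)
  have T: "((\<lambda>w. tail_term w z) has_sum wp_tail z) (L - {0})"
    unfolding wp_tail_def by (intro has_sum_infsum summable_tail) (use assms in auto)
  have "((\<lambda>w. 2 * z * (1 / w ^ 3) + 3 * z ^ 2 * (1 / w ^ 4) + 4 * z ^ 3 * (1 / w ^ 5)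
    + 5 * z ^ 4 * (1 / w ^ 6) + 6 * z ^ 5 * (1 / w ^ 7) + z ^ 6 * tail_term w z) has_sum
    (2 * z * eisenstein_G 3 w1 w2 + 3 * z ^ 2 * eisenstein_G 4 w1 w2 + 4 * z ^ 3 * eisenstein_G 5 w1 w2
    + 5 * z ^ 4 * eisenstein_G 6 w1 w2 + 6 * z ^ 5 * eisenstein_G 7 w1 w2 + z ^ 6 * wp_tail z)) (L - {0})"
    by (intro has_sum_add has_sum_cmult_right G T) auto
  also have "?this \<longleftrightarrow> ((\<lambda>w. 1 / (z - w) ^ 2 - 1 / w ^ 2) has_sum
    (2 * z * eisenstein_G 3 w1 w2 + 3 * z ^ 2 * eisenstein_G 4 w1 w2 + 4 * z ^ 3 * eisenstein_G 5 w1 w2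
    + 5 * z ^ 4 * eisenstein_G 6 w1 w2 + 6 * z ^ 5 * eisenstein_G 7 w1 w2 + z ^ 6 * wp_tail z)) (L - {0})"
    by (rule has_sum_cong) (subst wp_term_expansion, use assms in auto)
  finally show ?thesis
    by (simp add: eisenstein_odd mult_ac)
qed

text \<open>Order 6 is the right place to stop: in \<open>wp'^2\<close> and \<open>wp^3\<close> the
  remainder meets factors with poles of order at most 4, so it contributes only terms vanishing at
  0.\<close>

lemma wp_expansion:
  assumes "z \<notin> L"
  shows "wp z = 1 / z ^ 2 + 3 * eisenstein_G 4 w1 w2 * z ^ 2
    + 5 * eisenstein_G 6 w1 w2 * z ^ 4 + z ^ 6 * wp_tail z"
  using infsumI[OF wp_terms_has_sum[OF assms]] by (simp add: weierstrass_p_def)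

lemma holomorphic_wp: "wp holomorphic_on - L"
proof -
  have "(\<lambda>z. 1 / z ^ 2 + 3 * eisenstein_G 4 w1 w2 * z ^ 2
    + 5 * eisenstein_G 6 w1 w2 * z ^ 4 + z ^ 6 * wp_tail z) holomorphic_on - L"
    by (intro holomorphic_intros holomorphic_on_subset[OF holomorphic_wp_tail]) auto
  then show ?thesis
    by (rule holomorphic_transform) (simp add: wp_expansion)
qed

text \<open>Here \<open>w = 0\<close> contributes the principal part, since \<open>1 / 0\<^sup>2 = 0\<close>.\<close>
lemma wp_terms_has_sum_lattice:
  assumes "z \<notin> L"
  shows "((\<lambda>w. 1 / (z - w) ^ 2 - 1 / w ^ 2) has_sum wp z) L"
proof -
  have "((\<lambda>w. 1 / (z - w) ^ 2 - 1 / w ^ 2) has_sum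
    infsum (\<lambda>w. 1 / (z - w) ^ 2 - 1 / w ^ 2) (L - {0})) (L - {0})"
    using has_sum_infsum[OF has_sum_imp_summable[OF wp_terms_has_sum[OF assms]]] .
  then have "((\<lambda>w. 1 / (z - w) ^ 2 - 1 / w ^ 2) has_sum
    (1 / (z - 0) ^ 2 - 1 / 0 ^ 2 + infsum (\<lambda>w. 1 / (z - w) ^ 2 - 1 / w ^ 2) (L - {0}))) (insert 0 (L - {0}))"
    by (intro has_sum_insert) auto
  then show ?thesis
    by (simp add: weierstrass_p_def insert_absorb)
qed

lemma wp_even: "wp (- z) = wp z"
proof -
  have "infsum (\<lambda>w. 1 / (- z - w) ^ 2 - 1 / w ^ 2) (L - {0}) = infsum (\<lambda>w. 1 / (z - w) ^ 2 - 1 / w ^ 2) (L - {0})"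
  proof (rule infsum_reindex_bij_witness[where i = uminus and j = uminus])
    fix w :: complex
    have "(z - - w) ^ 2 = (- z - w) ^ 2" by (simp add: power2_eq_square algebra_simps)
    then show "1 / (z - - w) ^ 2 - 1 / (- w) ^ 2 = 1 / (- z - w) ^ 2 - 1 / w ^ 2" by simp
  qed auto
  then show ?thesis by (simp add: weierstrass_p_def)
qed

text \<open>Reindexing the series by \<open>l\<close> turns \<open>wp (z + l) - wp z\<close> into a
  lattice sum that no longer involves \<open>z\<close>, so it can be evaluated by symmetry, without
  differentiating.\<close>

lemma wp_periodic:
  assumes "z \<notin> L" "l \<in> L"
  shows "wp (z + l) = wp z"
proof -
  have zl: "z + l \<notin> L" using assms lattice_add_iff by blast
  have "((\<lambda>w. 1 / (z - w) ^ 2 - 1 / (w + l) ^ 2) has_sum wp (z + l)) L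
    \<longleftrightarrow> ((\<lambda>w. 1 / (z + l - w) ^ 2 - 1 / w ^ 2) has_sum wp (z + l)) L"
    by (rule has_sum_reindex_bij_witness[where j = "\<lambda>w. w + l" and i = "\<lambda>w. w - l"])
       (use assms(2) lattice_add lattice_diff in auto)
  then have "((\<lambda>w. 1 / (z - w) ^ 2 - 1 / (w + l) ^ 2) has_sum wp (z + l)) L"
    using wp_terms_has_sum_lattice[OF zl] by blast
  from has_sum_add[OF this has_sum_uminusI[OF wp_terms_has_sum_lattice[OF assms(1)]]]
  have s: "((\<lambda>w. 1 / w ^ 2 - 1 / (w + l) ^ 2) has_sum (wp (z + l) - wp z)) L" by simp
  \<comment> \<open>The reflection \<open>w \<mapsto> - w - l\<close> of the lattice changes the sign of this sum.\<close>
  have "((\<lambda>w. 1 / w ^ 2 - 1 / (w + l) ^ 2) has_sum (wp (z + l) - wp z)) L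
    \<longleftrightarrow> ((\<lambda>w. - (1 / w ^ 2 - 1 / (w + l) ^ 2)) has_sum (wp (z + l) - wp z)) L"
  proof (rule has_sum_reindex_bij_witness[where j = "\<lambda>w. - w - l" and i = "\<lambda>w. - w - l"])
    fix w :: complex assume "w \<in> L"
    then show "- w - l \<in> L" "- w - l \<in> L"
      using lattice_diff[of "- w" l] assms(2) by simp_all
    have "(- w - l) ^ 2 = (w + l) ^ 2" "(- w - l + l) ^ 2 = w ^ 2"
      by (simp_all add: power2_eq_square algebra_simps)
    then show "- (1 / (- w - l) ^ 2 - 1 / (- w - l + l) ^ 2) = 1 / w ^ 2 - 1 / (w + l) ^ 2" by simp
  qed (use assms(2) in auto)
  with s have "((\<lambda>w. - (1 / w ^ 2 - 1 / (w + l) ^ 2)) has_sum (wp (z + l) - wp z)) L" by simp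
  from has_sum_unique[OF this has_sum_uminusI[OF s]] show ?thesis
    by simp
qed


section \<open>Elliptic functions without poles\<close>

lemma periodic_extend:
  assumes "\<And>z. z \<notin> L \<Longrightarrow> f (z + w1) = f z" "\<And>z. z \<notin> L \<Longrightarrow> f (z + w2) = f z"
    and "z \<notin> L" "l \<in> L"
  shows "f (z + l) = f z"
proof -
  have int_multiple: "f (z + of_int m * w) = f z"
    if w: "w \<in> L" "\<And>z. z \<notin> L \<Longrightarrow> f (z + w) = f z" and z: "z \<notin> L" for m :: int and w z
  proof -
    have nL: "z + of_int m * w \<notin> L" for m :: int
    proof -
      have "of_int m * w \<in> L"
      proof -
        obtain i j :: int where "w = of_int i * w1 + of_int j * w2"
          using w(1) by (auto simp: period_lattice_def)
        then have "of_int m * w = of_int (m * i) * w1 + of_int (m * j) * w2"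
          by (simp add: algebra_simps)
        then show ?thesis by (metis lattice_memI)
      qed
      then show ?thesis using z lattice_add_iff by blast
    qed
    show ?thesis
    proof (induction m rule: int_induct[where k = 0])
      case (step1 i)
      then show ?case using w(2)[OF nL[of i]] by (simp add: algebra_simps)
    next
      case (step2 i)
      then show ?case using w(2)[OF nL[of "i - 1"]] by (simp add: algebra_simps)
    qed simp
  qed
  obtain m n :: int where l: "l = of_int m * w1 + of_int n * w2"
    using assms(4) by (auto simp: period_lattice_def)
  have "of_int m * w1 \<in> L" using lattice_memI[of m 0] by simp
  then have "z + of_int m * w1 \<notin> L" using assms(3) lattice_add_iff by blast
  then have "f (z + of_int m * w1 + of_int n * w2) = f (z + of_int m * w1)"
    using int_multiple[of w2] assms(2) by simp
  also have "\<dots> = f z"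
    using int_multiple[of w1] assms(1,3) by simp
  finally show ?thesis by (simp add: l add.assoc)
qed

text \<open>Liouville's theorem. A limit at 0 is enough, since periodicity carries it to every
  lattice point; the extended function is entire, and its values on one closed period parallelogram
  are all its values.\<close>

lemma elliptic_function_constant:
  assumes hol: "f holomorphic_on - L"
    and per: "\<And>z. z \<notin> L \<Longrightarrow> f (z + w1) = f z" "\<And>z. z \<notin> L \<Longrightarrow> f (z + w2) = f z"
    and lim: "f \<midarrow>0\<rightarrow> c"
    and "z \<notin> L"
  shows "f z = c"
proof -
  define F where "F z = (if z \<in> L then c else f z)" for z
  have F_per: "F (z + l) = F z" if "l \<in> L" for z l
    using that periodic_extend[OF per] lattice_add_iff[of l z] by (auto simp: F_def)
  obtain d where d: "d > 0" "ball 0 d \<subseteq> - (L - {0})" using lattice_isolated_0 by blast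
  define G where "G z = (if z = 0 then c else f z)" for z
  have "G holomorphic_on ball 0 d"
    unfolding G_def by (rule removable_singularity[OF _ _ lim]) (use d hol in \<open>auto intro: holomorphic_on_subset\<close>)
  then have G: "G analytic_on {0}" using d(1) by (auto simp: analytic_at intro!: exI[of _ "ball 0 d"])
  have F_hol: "F holomorphic_on UNIV"
  proof -
    have "F analytic_on {u}" for u
    proof (cases "u \<in> L")
      case False
      have "f analytic_on {u}" using False hol open_compl_lattice by (auto simp: analytic_at)
      moreover have "\<forall>\<^sub>F y in nhds u. F y = f y"
        using eventually_nhds_in_open[OF open_compl_lattice, of u] False
        by (auto elim!: eventually_mono simp: F_def)
      ultimately show ?thesis using analytic_at_cong by blast
    next
      case True
      \<comment> \<open>Near a lattice point \<open>u\<close> the extension \<open>F\<close> is the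
        translate by \<open>u\<close> of \<open>G\<close>, whose singularity at 0 has been
        removed.\<close>
      have "G \<circ> (\<lambda>y. y - u) analytic_on {u}"
        by (intro analytic_on_compose_gen[OF _ G] analytic_intros) auto
      moreover have "\<forall>\<^sub>F y in nhds u. F y = (G \<circ> (\<lambda>y. y - u)) y"
      proof -
        have "F y = (G \<circ> (\<lambda>y. y - u)) y" if "y \<in> ball u d" for y
        proof -
          have "y - u \<in> ball 0 d" using that by (simp add: dist_norm norm_minus_commute)
          then have "y - u \<in> L \<longleftrightarrow> y - u = 0" using d(2) by auto
          moreover have "F y = F (y - u)" using F_per[OF True, of "y - u"] by simp
          ultimately show ?thesis by (simp add: F_def G_def)
        qed
        then show ?thesis
          using eventually_nhds_in_open[OF open_ball, of u u d] d(1) by (auto elim!: eventually_mono)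
      qed
      ultimately show ?thesis using analytic_at_cong by blast
    qed
    then show ?thesis
      using analytic_imp_holomorphic analytic_on_analytic_at by blast
  qed
  define Q where "Q = (\<lambda>(s::real, t::real). of_real s * w1 + of_real t * w2) ` ({0..1} \<times> {0..1})"
  have "compact Q"
    unfolding Q_def case_prod_unfold
    by (intro compact_continuous_image continuous_intros compact_Times compact_Icc)
  then have "compact (F ` Q)"
    using F_hol by (intro compact_continuous_image holomorphic_on_imp_continuous_on) (auto intro: holomorphic_on_subset)
  moreover have "range F \<subseteq> F ` Q"
  proof clarify
    fix u
    obtain s t :: real where u: "u = of_real s * w1 + of_real t * w2" using coordinates_exist by blast
    define u' where "u' = of_real (frac s) * w1 + of_real (frac t) * w2"
    have "u = u' + (of_int \<lfloor>s\<rfloor> * w1 + of_int \<lfloor>t\<rfloor> * w2)"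
      by (simp add: u u'_def frac_def algebra_simps)
    then have "F u = F u'" using F_per[of "of_int \<lfloor>s\<rfloor> * w1 + of_int \<lfloor>t\<rfloor> * w2" u'] by auto
    moreover have "u' \<in> Q"
      unfolding Q_def u'_def using frac_ge_0 frac_lt_1 less_imp_le
      by (intro image_eqI[where x = "(frac s, frac t)"]) auto
    ultimately show "F u \<in> F ` Q" by blast
  qed
  ultimately have "bounded (range F)"
    using bounded_subset compact_imp_bounded by blast
  then have "F constant_on UNIV" using Liouville_theorem[OF F_hol] by blast
  then have "F z = F 0" by (auto simp: constant_on_def)
  then show ?thesis using \<open>z \<notin> L\<close> by (simp add: F_def)
qed

lemma periodic_deriv:
  assumes hol: "f holomorphic_on - L" and per: "\<And>z. z \<notin> L \<Longrightarrow> f (z + l) = f z"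
    and "l \<in> L" "z \<notin> L"
  shows "deriv f (z + l) = deriv f z"
proof -
  have "z + l \<in> - L" using assms lattice_add_iff by auto
  then have "(f has_field_derivative deriv f (z + l)) (at (z + l))"
    using hol open_compl_lattice by (blast intro: holomorphic_derivI)
  then have "((\<lambda>x. f (x + l)) has_field_derivative deriv f (z + l)) (at z)"
    by (simp add: DERIV_shift)
  then have "(f has_field_derivative deriv f (z + l)) (at z)"
    by (rule has_field_derivative_transform_within_open[OF _ open_compl_lattice]) (use assms in auto)
  then show ?thesis by (simp add: DERIV_imp_deriv)
qed

lemma holomorphic_deriv_wp: "deriv wp holomorphic_on - L"
  by (rule holomorphic_deriv[OF holomorphic_wp open_compl_lattice])

lemma holomorphic_deriv2_wp: "deriv (deriv wp) holomorphic_on - L"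
  by (rule holomorphic_deriv[OF holomorphic_deriv_wp open_compl_lattice])

lemma deriv_wp_periodic: "z \<notin> L \<Longrightarrow> l \<in> L \<Longrightarrow> deriv wp (z + l) = deriv wp z"
  by (rule periodic_deriv[OF holomorphic_wp wp_periodic])

lemma deriv2_wp_periodic:
  "z \<notin> L \<Longrightarrow> l \<in> L \<Longrightarrow> deriv (deriv wp) (z + l) = deriv (deriv wp) z"
  by (rule periodic_deriv[OF holomorphic_deriv_wp deriv_wp_periodic])

section \<open>The differential equations of \<open>wp\<close>\<close>

context
  fixes a b :: complex and r r1 r2 :: "complex \<Rightarrow> complex"
  defines "a \<equiv> 3 * eisenstein_G 4 w1 w2" and "b \<equiv> 5 * eisenstein_G 6 w1 w2"
    and "r \<equiv> wp_tail" and "r1 \<equiv> deriv wp_tail" and "r2 \<equiv> deriv (deriv wp_tail)"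
begin

lemma tail_derivs:
  assumes "z \<notin> L - {0}"
  shows "(r has_field_derivative r1 z) (at z)" "(r1 has_field_derivative r2 z) (at z)" "isCont r2 z"
proof -
  have h1: "r1 holomorphic_on - (L - {0})"
    unfolding r1_def by (rule holomorphic_deriv[OF holomorphic_wp_tail open_compl_lattice_nz])
  have h2: "r2 holomorphic_on - (L - {0})"
    using holomorphic_deriv[OF h1 open_compl_lattice_nz] by (simp add: r1_def r2_def)
  show "(r has_field_derivative r1 z) (at z)" 
    unfolding r_def r1_def by (rule holomorphic_derivI[OF holomorphic_wp_tail open_compl_lattice_nz]) (use assms in auto)
  have "(r1 has_field_derivative deriv r1 z) (at z)" 
    by (rule holomorphic_derivI[OF h1 open_compl_lattice_nz]) (use assms in auto)
  then show "(r1 has_field_derivative r2 z) (at z)" by (simp add: r1_def r2_def)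
  show "isCont r2 z"
    using continuous_on_interior[OF holomorphic_on_imp_continuous_on[OF h2], of z] open_compl_lattice_nz assms
    by (metis Compl_iff interior_open)
qed

lemma wp_laurent:
  assumes "z \<notin> L"
  shows "wp z = 1 / z ^ 2 + a * z ^ 2 + b * z ^ 4 + z ^ 6 * r z"
    and "deriv wp z = - 2 / z ^ 3 + 2 * a * z + 4 * b * z ^ 3 + 6 * z ^ 5 * r z + z ^ 6 * r1 z"
    and "deriv (deriv wp) z = 6 / z ^ 4 + 2 * a + 12 * b * z ^ 2 + 30 * z ^ 4 * r z
      + 12 * z ^ 5 * r1 z + z ^ 6 * r2 z"
proof -
  have 0: "wp z = 1 / z ^ 2 + a * z ^ 2 + b * z ^ 4 + z ^ 6 * r z" if "z \<notin> L" for z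
    using wp_expansion[OF that] by (simp add: a_def b_def r_def)
  have 1: "deriv wp z = - 2 / z ^ 3 + 2 * a * z + 4 * b * z ^ 3 + 6 * z ^ 5 * r z + z ^ 6 * r1 z"
    if z: "z \<notin> L" for z
  proof (rule DERIV_imp_deriv)
    have "z \<noteq> 0" using z by auto
    then have "((\<lambda>z. 1 / z ^ 2 + a * z ^ 2 + b * z ^ 4 + z ^ 6 * r z) has_field_derivative
        (- 2 / z ^ 3 + 2 * a * z + 4 * b * z ^ 3 + 6 * z ^ 5 * r z + z ^ 6 * r1 z)) (at z)"
      using z by (auto intro!: derivative_eq_intros tail_derivs simp: field_simps eval_nat_numeral)
    then show "(wp has_field_derivative
        (- 2 / z ^ 3 + 2 * a * z + 4 * b * z ^ 3 + 6 * z ^ 5 * r z + z ^ 6 * r1 z)) (at z)"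
      by (rule has_field_derivative_transform_within_open[OF _ open_compl_lattice]) (use z 0 in auto)
  qed
  have 2: "deriv (deriv wp) z = 6 / z ^ 4 + 2 * a + 12 * b * z ^ 2 + 30 * z ^ 4 * r z
      + 12 * z ^ 5 * r1 z + z ^ 6 * r2 z"
    if z: "z \<notin> L" for z
  proof (rule DERIV_imp_deriv)
    have "z \<noteq> 0" using z by auto
    then have "((\<lambda>z. - 2 / z ^ 3 + 2 * a * z + 4 * b * z ^ 3 + 6 * z ^ 5 * r z + z ^ 6 * r1 z) has_field_derivative
        (6 / z ^ 4 + 2 * a + 12 * b * z ^ 2 + 30 * z ^ 4 * r z + 12 * z ^ 5 * r1 z + z ^ 6 * r2 z)) (at z)"
      using z by (auto intro!: derivative_eq_intros tail_derivs simp: field_simps eval_nat_numeral)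
    then show "(deriv wp has_field_derivative
        (6 / z ^ 4 + 2 * a + 12 * b * z ^ 2 + 30 * z ^ 4 * r z + 12 * z ^ 5 * r1 z + z ^ 6 * r2 z)) (at z)"
      by (rule has_field_derivative_transform_within_open[OF _ open_compl_lattice]) (use z 1 in auto)
  qed
  show "wp z = 1 / z ^ 2 + a * z ^ 2 + b * z ^ 4 + z ^ 6 * r z"
    and "deriv wp z = - 2 / z ^ 3 + 2 * a * z + 4 * b * z ^ 3 + 6 * z ^ 5 * r z + z ^ 6 * r1 z"
    and "deriv (deriv wp) z = 6 / z ^ 4 + 2 * a + 12 * b * z ^ 2 + 30 * z ^ 4 * r z
      + 12 * z ^ 5 * r1 z + z ^ 6 * r2 z"
    using 0 1 2 assms by blast+
qed

lemma eventually_not_lattice: "\<forall>\<^sub>F z in at 0. z \<notin> L"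
proof -
  obtain d where d: "d > 0" "ball 0 d \<subseteq> - (L - {0})" using lattice_isolated_0 by blast
  then show ?thesis
    unfolding eventually_at by (auto intro!: exI[of _ d] simp: subset_iff dist_commute)
qed

lemma tail_isCont_0: "isCont r 0" "isCont r1 0" "isCont r2 0"
  using tail_derivs[of 0] by (auto dest: DERIV_isCont)

text \<open>The combination is chosen so that the pole of order 4 and the constant term cancel at 0;
  with \<open>a = 3 G4\<close>, the constant \<open>10 * a\<close> is \<open>g2 / 2\<close>.\<close>

lemma second_order_differential_equation:
  assumes "z \<notin> L"
  shows "deriv (deriv wp) z = 6 * wp z ^ 2 - invariant_g2 w1 w2 / 2"
proof -
  define f where "f z = deriv (deriv wp) z - 6 * wp z ^ 2 + 10 * a" for z
  \<comment> \<open>This is \<open>f\<close> after cancellation of its principal part, written so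
    that it is visibly continuous with value 0 at 0.\<close>
  define h where "h z = z ^ 4 * (18 * r z + 12 * z * r1 z + z ^ 2 * r2 z - 6 * (a + b * z ^ 2 + z ^ 4 * r z) ^ 2)" for z
  have fh: "h z = f z" if "z \<notin> L" for z
  proof -
    \<comment> \<open>Treating \<open>1 / z\<close> as a separate unknown with
      \<open>q * z = 1\<close> makes the claim a polynomial identity.\<close>
    define q where "q = 1 / z"
    have q: "q * z = 1" using that by (auto simp: q_def)
    have e: "1 / z ^ 2 = q ^ 2" "6 / z ^ 4 = 6 * q ^ 4" by (simp_all add: q_def power_divide)
    show ?thesis
      unfolding f_def h_def wp_laurent[OF that] e using q by algebra
  qed
  have "isCont h 0" unfolding h_def by (intro continuous_intros tail_isCont_0)
  then have "h \<midarrow>0\<rightarrow> 0" by (simp add: isCont_def h_def)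
  then have lim: "f \<midarrow>0\<rightarrow> 0"
    by (rule Lim_transform_eventually) (use eventually_not_lattice fh in \<open>auto elim: eventually_mono\<close>)
  have "f z = 0"
  proof (rule elliptic_function_constant[OF _ _ _ lim assms])
    show "f holomorphic_on - L"
      unfolding f_def by (intro holomorphic_intros holomorphic_wp holomorphic_deriv2_wp)
  qed (simp_all add: f_def wp_periodic deriv2_wp_periodic)
  then show ?thesis
    by (simp add: f_def a_def invariant_g2_def algebra_simps)
qed

lemma differential_equation:
  assumes "z \<notin> L"
  shows "deriv wp z ^ 2 = 4 * wp z ^ 3 - invariant_g2 w1 w2 * wp z - invariant_g3 w1 w2"
proof -
  \<comment> \<open>In terms of the Laurent coefficients, \<open>20 * a\<close> is \<open>g2\<close>
    and \<open>28 * b\<close> is \<open>g3\<close>; they cancel the double pole and the constant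
    term.\<close>
  define f where "f z = deriv wp z ^ 2 - 4 * wp z ^ 3 + 20 * a * wp z + 28 * b" for z
  define E where "E z = a + b * z ^ 2 + z ^ 4 * r z" for z
  define N where "N z = 6 * r z + z * r1 z" for z
  define h where "h z = z ^ 2 * (- 4 * N z + (2 * a + 4 * b * z ^ 2 + z ^ 4 * N z) ^ 2 - 12 * r z
    - 12 * E z ^ 2 - 4 * z ^ 4 * E z ^ 3 + 20 * a * E z)" for z
  have fh: "h z = f z" if "z \<notin> L" for z
  proof -
    define q where "q = 1 / z"
    have q: "q * z = 1" using that by (auto simp: q_def)
    have e: "1 / z ^ 2 = q ^ 2" "- 2 / z ^ 3 = - 2 * q ^ 3" by (simp_all add: q_def power_divide)
    have p0: "wp z = q ^ 2 + z ^ 2 * E z"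
      unfolding wp_laurent[OF that] e E_def by algebra
    have p1: "deriv wp z = - 2 * q ^ 3 + z * (2 * a + 4 * b * z ^ 2 + z ^ 4 * N z)"
      unfolding wp_laurent[OF that] e N_def by algebra
    have NE: "r z * z ^ 4 = E z - a - b * z ^ 2" by (simp add: E_def)
    show ?thesis
      unfolding f_def h_def p0 p1 using q NE by algebra
  qed
  have "isCont h 0" unfolding h_def E_def N_def by (intro continuous_intros tail_isCont_0)
  then have "h \<midarrow>0\<rightarrow> 0" by (simp add: isCont_def h_def)
  then have lim: "f \<midarrow>0\<rightarrow> 0"
    by (rule Lim_transform_eventually) (use eventually_not_lattice fh in \<open>auto elim: eventually_mono\<close>)
  have "f z = 0"
  proof (rule elliptic_function_constant[OF _ _ _ lim assms])
    show "f holomorphic_on - L"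
      unfolding f_def by (intro holomorphic_intros holomorphic_wp holomorphic_deriv_wp)
  qed (simp_all add: f_def wp_periodic deriv_wp_periodic)
  then show ?thesis
    by (simp add: f_def a_def b_def invariant_g2_def invariant_g3_def algebra_simps)
qed

end


section \<open>The relation at a third of a period\<close>

lemma third_period_notin_lattice: "w2 / 3 \<notin> L"
proof
  assume "w2 / 3 \<in> L"
  then obtain m n :: int where "w2 / 3 = of_int m * w1 + of_int n * w2"
    by (auto simp: period_lattice_def)
  then have "of_real 0 * w1 + of_real (1/3) * w2 = of_real (of_int m) * w1 + of_real (of_int n) * w2"
    by simp
  from coordinates_unique(2)[OF this] have "real_of_int (3 * n) = real_of_int 1" by simp
  then have "3 * n = 1" by (simp only: of_int_eq_iff)
  then show False by presburger
qed

lemma wp_derivs: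
  assumes "z \<notin> L"
  shows "(wp has_field_derivative deriv wp z) (at z)"
    and "(deriv wp has_field_derivative deriv (deriv wp) z) (at z)"
  using assms holomorphic_wp holomorphic_deriv_wp open_compl_lattice by (auto intro: holomorphic_derivI)

text \<open>Obtained by differentiating the second-order equation; it supplies the third Taylor
  coefficient at \<open>z0\<close>.\<close>

lemma deriv3_wp:
  assumes "z \<notin> L"
  shows "deriv (deriv (deriv wp)) z = 12 * wp z * deriv wp z"
proof (rule DERIV_imp_deriv)
  have "((\<lambda>z. 6 * wp z ^ 2 - invariant_g2 w1 w2 / 2) has_field_derivative 12 * wp z * deriv wp z) (at z)"
    using wp_derivs(1)[OF assms] by (auto intro!: derivative_eq_intros)
  then show "(deriv (deriv wp) has_field_derivative 12 * wp z * deriv wp z) (at z)"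
    by (rule has_field_derivative_transform_within_open[OF _ open_compl_lattice])
       (use assms second_order_differential_equation in auto)
qed

text \<open>With \<open>p = \<wp>(z\<^sub>0)\<close>, the product of the three translates of \<open>\<wp> - p\<close> by multiples of \<open>z\<^sub>0\<close> has
  periods \<open>w\<^sub>1\<close> and \<open>z\<^sub>0\<close>, and its zeros cancel its poles, so it is constant. The relation
  is the vanishing of its second Taylor coefficient at \<open>0\<close>.\<close>
lemma three_division_relation:
  fixes z0 :: complex
  defines "z0 \<equiv> w2 / 3"
  shows "12 * wp z0 * deriv wp z0 ^ 2 = deriv (deriv wp) z0 ^ 2"
proof -
  define x where "x = wp z0"
  define p1 where "p1 = deriv wp z0"
  define p2 where "p2 = deriv (deriv wp) z0"
  have z0: "z0 \<notin> L" using third_period_notin_lattice by (simp add: z0_def)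
  \<comment> \<open>The finer lattice contains \<open>L\<close>, and its points are the only places
    where any of the three translates can have a pole.\<close>
  interpret T: complex_lattice w1 z0
    by standard (use indep in \<open>simp add: z0_def\<close>)
  have L_T: "l \<in> T.L" if l: "l \<in> L" for l
  proof -
    obtain m n :: int where "l = of_int m * w1 + of_int n * w2"
      using l by (auto simp: period_lattice_def)
    then have "l = of_int m * w1 + of_int (3 * n) * z0" by (simp add: z0_def)
    then show ?thesis using T.lattice_memI by metis
  qed
  have T_nL: "z \<notin> L" "z + z0 \<notin> L" "z - z0 \<notin> L" if "z \<notin> T.L" for z
    using that L_T[of z] L_T[of "z + z0"] L_T[of "z - z0"] T.lattice_add_iff[of z0 z]
      T.lattice_add_iff[of z0 "z - z0"] by auto
  define A where "A h = wp (z0 + h) - x" for h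
  define E where "E z = 3 * eisenstein_G 4 w1 w2 + 5 * eisenstein_G 6 w1 w2 * z ^ 2 + z ^ 4 * wp_tail z" for z
  have wp_E: "z ^ 2 * (wp z - x) = 1 - x * z ^ 2 + z ^ 4 * E z" if "z \<notin> L" for z
  proof -
    have "z \<noteq> 0" using that by auto
    then have "z ^ 2 * (1 / z ^ 2) = 1" by simp
    then show ?thesis unfolding wp_expansion[OF that] E_def by algebra
  qed
  have E_hol: "E holomorphic_on - (L - {0})"
    unfolding E_def by (intro holomorphic_intros holomorphic_wp_tail)
  then have E_ana: "E analytic_on {0}"
    using open_compl_lattice_nz by (auto simp: analytic_at intro!: exI[of _ "- (L - {0})"])
  define P where "P z = (wp z - x) * (wp (z + z0) - x) * (wp (z - z0) - x)" for z
  \<comment> \<open>Evenness turns \<open>wp (z - z0)\<close> into \<open>wp (z0 - z)\<close>, so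
    both translates are expressed by the same local function \<open>A\<close>.\<close>
  have P_eq: "z ^ 2 * P z = (1 - x * z ^ 2 + z ^ 4 * E z) * (A z * A (- z))" if "z \<notin> L" for z
    using wp_E[OF that] wp_even[of "z - z0"] by (simp add: P_def A_def add.commute mult.assoc[symmetric])
  \<comment> \<open>The double pole of \<open>wp z - x\<close> at 0 is cancelled by a zero of each
    other factor; their slopes \<open>p1\<close> and \<open>- p1\<close> give the limit.\<close>
  have P_const: "P z = - (p1 ^ 2)" if "z \<notin> T.L" for z
  proof (rule T.elliptic_function_constant[OF _ _ _ _ that])
    have "(\<lambda>z. wp (z + z0)) holomorphic_on - T.L" "(\<lambda>z. wp (z - z0)) holomorphic_on - T.L"
      by (rule holomorphic_on_compose_gen[OF _ holomorphic_wp, unfolded o_def],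
          auto intro!: holomorphic_intros dest: T_nL)+
    moreover have "wp holomorphic_on - T.L"
      by (rule holomorphic_on_subset[OF holomorphic_wp]) (use L_T in blast)
    ultimately show "P holomorphic_on - T.L"
      unfolding P_def by (intro holomorphic_intros)
  next
    fix z assume z: "z \<notin> T.L"
    have "z + w1 + z0 = z + z0 + w1" "z + w1 - z0 = z - z0 + w1" by simp_all
    then show "P (z + w1) = P z"
      using wp_periodic[OF T_nL(1)[OF z] w1_in_lattice] wp_periodic[OF T_nL(2)[OF z] w1_in_lattice]
        wp_periodic[OF T_nL(3)[OF z] w1_in_lattice] by (simp only: P_def)
    \<comment> \<open>Translation by \<open>z0\<close> permutes the three factors cyclically,
      because \<open>2 * z0 = - z0 + w2\<close>.\<close>
    have shift: "z + z0 + z0 = z - z0 + w2" "z + z0 - z0 = z" by (simp_all add: z0_def)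
    then show "P (z + z0) = P z"
      unfolding P_def shift wp_periodic[OF T_nL(3)[OF z] w2_in_lattice] by (simp only: mult_ac)
  next
    have d: "(wp has_field_derivative p1) (at z0)"
      unfolding p1_def by (rule wp_derivs(1)[OF z0])
    have "(A has_field_derivative p1) (at 0)" "((\<lambda>h. A (- h)) has_field_derivative - p1) (at 0)"
      unfolding A_def using d by (auto intro!: derivative_eq_intros DERIV_chain2[of wp])
    then have l: "(\<lambda>h. A h / h) \<midarrow>0\<rightarrow> p1" "(\<lambda>h. A (- h) / h) \<midarrow>0\<rightarrow> - p1"
      by (auto simp: DERIV_def A_def x_def)
    have "isCont E 0" using E_ana by (rule analytic_at_imp_isCont)
    then have "isCont (\<lambda>z. 1 - x * z ^ 2 + z ^ 4 * E z) 0" by (intro continuous_intros)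
    then have "(\<lambda>z. 1 - x * z ^ 2 + z ^ 4 * E z) \<midarrow>0\<rightarrow> 1" by (simp add: isCont_def)
    from tendsto_mult[OF this tendsto_mult[OF l]]
    have lim: "(\<lambda>z. (1 - x * z ^ 2 + z ^ 4 * E z) * (A z / z * (A (- z) / z))) \<midarrow>0\<rightarrow> - (p1 ^ 2)"
      by (simp add: power2_eq_square)
    have eq: "(1 - x * z ^ 2 + z ^ 4 * E z) * (A z / z * (A (- z) / z)) = P z" if "z \<notin> L" for z
    proof -
      have "z \<noteq> 0" using that by auto
      then show ?thesis using P_eq[OF that] by (simp add: field_simps power2_eq_square)
    qed
    show "P \<midarrow>0\<rightarrow> - (p1 ^ 2)"
      by (rule Lim_transform_eventually[OF lim eventually_mono[OF eventually_not_lattice eq]])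
  qed
  define W where "W = fps_expansion wp z0 - fps_const x"
  have "wp analytic_on {z0}"
    using z0 holomorphic_wp open_compl_lattice by (auto simp: analytic_at intro!: exI[of _ "- L"])
  then have W: "A has_fps_expansion W"
    unfolding A_def W_def by (intro fps_expansion_intros analytic_at_imp_has_fps_expansion)
  have W': "(\<lambda>h. A (- h)) has_fps_expansion (W oo - fps_X)"
    using has_fps_expansion_compose[OF W, of uminus "- fps_X"]
    by (simp add: o_def fps_expansion_intros)
  define e where "e = fps_expansion E 0"
  have e: "E has_fps_expansion e"
    unfolding e_def by (rule analytic_at_imp_has_fps_expansion_0[OF E_ana])
  define S where "S = W * (W oo - fps_X)"
  have ex: "(\<lambda>z. (1 - x * z ^ 2 + z ^ 4 * E z) * (A z * A (- z))) has_fps_expansion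
      (1 - fps_const x * fps_X ^ 2 + fps_X ^ 4 * e) * S"
    unfolding S_def by (intro fps_expansion_intros W W' e)
  \<comment> \<open>At 0 both sides vanish since \<open>A 0 = 0\<close>, so the identity holds on a
    full neighbourhood and power series can be compared.\<close>
  have ev: "\<forall>\<^sub>F z in nhds 0. (1 - x * z ^ 2 + z ^ 4 * E z) * (A z * A (- z)) = z ^ 2 * - (p1 ^ 2)"
  proof -
    obtain d where d: "d > 0" "ball 0 d \<subseteq> - (T.L - {0})" using T.lattice_isolated_0 by blast
    have "(1 - x * z ^ 2 + z ^ 4 * E z) * (A z * A (- z)) = z ^ 2 * - (p1 ^ 2)" if "z \<in> ball 0 d" for z
    proof (cases "z = 0")
      case True
      then show ?thesis by (simp add: A_def x_def)
    next
      case False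
      then have "z \<notin> T.L" using that d(2) by auto
      then show ?thesis using P_eq[OF T_nL(1)] P_const by simp
    qed
    then show ?thesis
      using eventually_nhds_in_open[OF open_ball, of 0 0 d] d(1) by (auto elim!: eventually_mono)
  qed
  have "(\<lambda>z. z ^ 2 * - (p1 ^ 2)) has_fps_expansion
      (1 - fps_const x * fps_X ^ 2 + fps_X ^ 4 * e) * S"
    using ex has_fps_expansion_cong[OF ev refl] by simp
  moreover have "(\<lambda>z. z ^ 2 * - (p1 ^ 2)) has_fps_expansion fps_X ^ 2 * fps_const (- (p1 ^ 2))"
    by (intro fps_expansion_intros)
  ultimately have "(1 - fps_const x * fps_X ^ 2 + fps_X ^ 4 * e) * S = fps_X ^ 2 * fps_const (- (p1 ^ 2))"
    by (rule fps_expansion_unique_complex)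
  then have "S - fps_const x * (fps_X ^ 2 * S) + fps_X ^ 4 * (e * S) = fps_X ^ 2 * fps_const (- (p1 ^ 2))"
    by (simp add: algebra_simps)
  \<comment> \<open>Index 4 is the second coefficient of \<open>P\<close> shifted by the factor
    \<open>z^2\<close>; the right-hand side lives in degree 2 only.\<close>
  then have "fps_nth (S - fps_const x * (fps_X ^ 2 * S) + fps_X ^ 4 * (e * S)) 4
      = fps_nth (fps_X ^ 2 * fps_const (- (p1 ^ 2))) 4"
    by simp
  then have coeff: "fps_nth S 4 - x * fps_nth S 2 + fps_nth e 0 * fps_nth S 0 = 0"
    by (simp add: fps_X_power_mult_nth)
  \<comment> \<open>Coefficients up to 3 suffice, because in \<open>fps_nth S 4\<close> the fourth
    one is multiplied by \<open>fps_nth W 0 = 0\<close>. The last value is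
    \<open>12 * x * p1 / 3!\<close>.\<close>
  have Wn: "fps_nth W 0 = 0" "fps_nth W 1 = p1" "fps_nth W 2 = p2 / 2" "fps_nth W 3 = 2 * x * p1"
    using deriv3_wp[OF z0]
    by (simp_all add: W_def fps_expansion_def x_def p1_def p2_def eval_nat_numeral)
  have Sn: "fps_nth S n = (\<Sum>i=0..n. (- 1) ^ (n - i) * fps_nth W i * fps_nth W (n - i))" for n
    by (simp add: S_def fps_mult_nth fps_compose_uminus' mult_ac)
  have "fps_nth S 0 = 0" "fps_nth S 2 = - (p1 ^ 2)" "fps_nth S 4 = fps_nth W 2 ^ 2 - 4 * x * p1 ^ 2"
    using Wn by (simp_all add: Sn eval_nat_numeral)
  then have "(p2 / 2) ^ 2 - 3 * x * p1 ^ 2 = 0" using coeff Wn(3) by simp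
  then show ?thesis by (simp add: p1_def p2_def x_def power_divide)
qed

section \<open>Reality of \<open>wp\<close> for a rectangular lattice\<close>

context
  assumes real_w1: "cnj w1 = w1" and imaginary_w2: "cnj w2 = - w2"
begin

lemma cnj_in_lattice: "w \<in> L \<Longrightarrow> cnj w \<in> L"
  unfolding period_lattice_def
proof clarify
  fix m n :: int
  have "cnj (of_int m * w1 + of_int n * w2) = of_int m * w1 + of_int (- n) * w2"
    by (simp add: real_w1 imaginary_w2)
  then show "\<exists>ma na. cnj (of_int m * w1 + of_int n * w2) = of_int ma * w1 + of_int na * w2 \<and> True"
    by blast
qed

lemma wp_cnj: "wp (cnj z) = cnj (wp z)"
proof -
  have "infsum (\<lambda>w. 1 / (cnj z - w) ^ 2 - 1 / w ^ 2) (L - {0})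
      = infsum (\<lambda>w. cnj (1 / (z - w) ^ 2 - 1 / w ^ 2)) (L - {0})"
    by (rule infsum_reindex_bij_witness[where i = cnj and j = cnj]) (use cnj_in_lattice in auto)
  also have "\<dots> = cnj (infsum (\<lambda>w. 1 / (z - w) ^ 2 - 1 / w ^ 2) (L - {0}))"
    by (rule infsum_cnj)
  finally show ?thesis by (simp add: weierstrass_p_def)
qed

text \<open>Here conjugation coincides with negation, so \<open>wp_cnj\<close> and
  \<open>wp_even\<close> together fix \<open>wp z\<close> under conjugation. For the derivative, the
  same two symmetries give
  \<open>deriv wp z = cnj (deriv wp (- z)) = - deriv wp (- z)\<close>.\<close>

lemma wp_imaginary_axis:
  assumes "cnj z = - z" "z \<notin> L"
  shows "Im (wp z) = 0" "Re (deriv wp z) = 0"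
proof -
  have "cnj (wp z) = wp z" using wp_cnj[of z] assms(1) by (simp add: wp_even)
  then show "Im (wp z) = 0" by (simp add: complex_eq_iff)
  have "((cnj \<circ> wp \<circ> cnj) has_field_derivative cnj (deriv wp (- z))) (at z)"
    by (rule has_field_derivative_cnj_cnj) (use assms wp_derivs(1)[of "- z"] in simp)
  moreover have "cnj \<circ> wp \<circ> cnj = wp" by (simp add: fun_eq_iff wp_cnj)
  ultimately have 1: "deriv wp z = cnj (deriv wp (- z))" by (simp add: DERIV_imp_deriv)
  have "((\<lambda>z. wp (- z)) has_field_derivative deriv wp (- z) * (- 1)) (at z)"
    by (rule DERIV_chain2[of wp]) (use assms(2) wp_derivs(1)[of "- z"] in \<open>auto intro!: derivative_eq_intros\<close>)
  then have "deriv wp z = - deriv wp (- z)" by (simp add: wp_even DERIV_imp_deriv)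
  with 1 have "Re (deriv wp (- z)) = 0" "deriv wp z = - deriv wp (- z)"
    by (auto simp: complex_eq_iff)
  then show "Re (deriv wp z) = 0" by simp
qed

end

end

section \<open>Solving the 3-division equation over the reals\<close>

text \<open>Here \<open>m\<close> stands for \<open>k^2\<close>, \<open>x\<close> for
  \<open>wp z0\<close>, and \<open>\<i> * y\<close> for its derivative, whence
  \<open>- (y ^ 2)\<close>. Eliminating \<open>y\<close> leaves a quartic in \<open>x\<close>, which
  splits off \<open>x + 1 / 3\<close>.\<close>

lemma three_division_value:
  fixes m x y :: real
  defines "g2 \<equiv> 4 / 27 * (9 - 8 * m)" and "g3 \<equiv> 8 / 27\<^sup>2 * (8 * m ^ 2 - 36 * m + 27)"
  assumes m: "0 < m" "m < 1"
    and de: "- (y ^ 2) = 4 * x ^ 3 - g2 * x - g3"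
    and td: "12 * x * - (y ^ 2) = (6 * x ^ 2 - g2 / 2) ^ 2"
  shows "x = - 1 / 3" "y \<noteq> 0"
proof -
  show y: "y \<noteq> 0"
  proof
    assume "y = 0"
    \<comment> \<open>With \<open>y = 0\<close>, \<open>x\<close> is a root of the cubic and of its
      derivative, so the discriminant \<open>g2^3 - 27 g3^2\<close> must vanish.\<close>
    then have g2: "g2 = 12 * x ^ 2" using td by simp
    then have g3: "g3 = - 8 * x ^ 3" using de \<open>y = 0\<close> by (simp add: eval_nat_numeral)
    have "g2 ^ 3 - 27 * g3 ^ 2 = 0" unfolding g2 g3 by algebra
    moreover have "g2 ^ 3 - 27 * g3 ^ 2 = 4096 / 19683 * (m ^ 3 * (1 - m))"
      unfolding g2_def g3_def by (simp add: power_mult_distrib power_divide field_simps eval_nat_numeral)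
    ultimately show False using m by simp
  qed
  have "0 \<le> 12 * x * - (y ^ 2)" unfolding td by simp
  then have x: "x \<le> 0" using y by (simp add: mult_le_0_iff)
  \<comment> \<open>This moves the expected root to \<open>s = 0\<close>, with the scale
    \<open>4 / 9\<close> of the formula for \<open>d\<close>, which becomes
    \<open>1 - m / s\<close>.\<close>
  define s where "s = 9 * (x + 1 / 3) / 4"
  have x_s: "x = 4 * s / 9 - 1 / 3" by (simp add: s_def field_simps)
  have s: "s \<le> 3 / 4" using x by (simp add: s_def)
  have "12 * x * (4 * x ^ 3 - g2 * x - g3) - (6 * x ^ 2 - g2 / 2) ^ 2
      = - 1024 / 2187 * s * ((m - 3 * s / 2) ^ 2 + s ^ 2 * (3 / 4 - s))"
    unfolding x_s g2_def g3_def by (simp add: power_mult_distrib power_divide field_simps eval_nat_numeral)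
  moreover have "12 * x * (4 * x ^ 3 - g2 * x - g3) - (6 * x ^ 2 - g2 / 2) ^ 2 = 0"
    using de td by simp
  \<comment> \<open>For \<open>s \<le> 3 / 4\<close> both summands are nonnegative. If
    \<open>s\<close> is nonzero, the second vanishes only at \<open>s = 3 / 4\<close>, where the
    first would require \<open>m = 9 / 8\<close>, contradicting \<open>m < 1\<close>.\<close>
  moreover have "(m - 3 * s / 2) ^ 2 + s ^ 2 * (3 / 4 - s) \<noteq> 0" if "s \<noteq> 0"
  proof (cases "s = 3 / 4")
    case True
    have ne: "m - 3 * s / 2 \<noteq> 0" using m True by simp
    have zero: "s ^ 2 * (3 / 4 - s) = 0" using True by simp
    show ?thesis unfolding zero add_0_right by (rule power_not_zero[OF ne])
  next
    case False
    then have "0 < s ^ 2 * (3 / 4 - s)" using s that by simp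
    then show ?thesis using zero_le_power2[of "m - 3 * s / 2"] by linarith
  qed
  ultimately have "s = 0" by auto
  then show "x = - 1 / 3" using x_s by simp
qed

text \<open>Since \<open>inverse 0 = 0\<close>, \<open>f\<close> must be shown nonzero on a
  punctured neighbourhood; this follows from the difference quotient tending to \<open>D\<close>,
  which is nonzero.\<close>

lemma is_pole_inverse_simple_zero:
  fixes f :: "complex \<Rightarrow> complex"
  assumes "(f has_field_derivative D) (at z)" "D \<noteq> 0" "f z = 0" "c \<noteq> 0"
  shows "is_pole (\<lambda>w. a - c * inverse (f w)) z"
proof -
  have "((\<lambda>w. (f w - f z) / (w - z)) \<longlongrightarrow> D) (at z)"
    using assms(1) by (simp add: has_field_derivative_iff)
  then have "\<forall>\<^sub>F w in at z. (f w - f z) / (w - z) \<noteq> 0"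
    using assms(2) by (rule tendsto_imp_eventually_ne)
  then have "\<forall>\<^sub>F w in at z. f w \<noteq> 0"
    by (rule eventually_mono) (use assms(3) in auto)
  moreover have "f \<midarrow>z\<rightarrow> 0"
    using DERIV_isCont[OF assms(1)] assms(3) by (simp add: isCont_def)
  ultimately have "filterlim f (at 0) (at z)" by (simp add: filterlim_at)
  then have "filterlim (\<lambda>w. inverse (f w)) at_infinity (at z)"
    using filterlim_compose[OF filterlim_inverse_at_infinity] by blast
  then have "filterlim (\<lambda>w. - c * inverse (f w)) at_infinity (at z)"
    using assms(4) by (intro tendsto_mult_filterlim_at_infinity[OF tendsto_const]) auto
  then have "filterlim (\<lambda>w. a + - c * inverse (f w)) at_infinity (at z)"
    by (rule tendsto_add_filterlim_at_infinity[OF tendsto_const])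
  then show ?thesis by (simp add: is_pole_def)
qed

theorem theorem2:
  fixes k K K' :: real
  assumes "0 < k" and "k < 1" and "0 < K" and "0 < K'"
    and "invariant_g2 (of_real (2 * K)) (\<i> * of_real (2 * K')) = of_real (4 / 27 * (9 - 8 * k\<^sup>2))"
    and "invariant_g3 (of_real (2 * K)) (\<i> * of_real (2 * K'))
           = of_real (8 / 27\<^sup>2 * (8 * k ^ 4 - 36 * k\<^sup>2 + 27))"
  shows "is_pole
           (\<lambda>z. 1 - of_real (4 / 9 * k\<^sup>2) *
                   inverse (weierstrass_p (of_real (2 * K)) (\<i> * of_real (2 * K')) z + 1 / 3))
           (\<i> * of_real (2 / 3 * K'))"
proof -
  define w1 w2 :: complex where "w1 = of_real (2 * K)" and "w2 = \<i> * of_real (2 * K')"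
  interpret complex_lattice w1 w2
    by standard (use assms(3,4) in \<open>simp add: w1_def w2_def\<close>)
  define z where "z = w2 / 3"
  have z: "z = \<i> * of_real (2 / 3 * K')" by (simp add: z_def w2_def)
  have nL: "z \<notin> L" using third_period_notin_lattice by (simp add: z_def)
  have sym: "cnj w1 = w1" "cnj w2 = - w2" "cnj z = - z" by (simp_all add: w1_def w2_def z)
  define x y where "x = Re (wp z)" and "y = Im (deriv wp z)"
  have wp_z: "wp z = of_real x" "deriv wp z = \<i> * of_real y"
    using wp_imaginary_axis[OF sym nL] by (simp_all add: x_def y_def complex_eq_iff)
  define m where "m = k\<^sup>2"
  have m: "0 < m" "m < 1" using assms(1,2) by (simp_all add: m_def power_less_one_iff)
  define g2 g3 where "g2 = 4 / 27 * (9 - 8 * m)" and "g3 = 8 / 27\<^sup>2 * (8 * m ^ 2 - 36 * m + 27)"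
  have inv: "invariant_g2 w1 w2 = of_real g2" "invariant_g3 w1 w2 = of_real g3"
    using assms(5,6) by (simp_all add: w1_def w2_def g2_def g3_def m_def)
  \<comment> \<open>All quantities at \<open>z\<close> are real or purely imaginary, so the complex
    identities descend to real equations in \<open>x\<close> and \<open>y\<close>.\<close>
  have "of_real (- (y ^ 2)) = (of_real (4 * x ^ 3 - g2 * x - g3) :: complex)"
    using differential_equation[OF nL] by (simp add: wp_z inv power_mult_distrib)
  then have de: "- (y ^ 2) = 4 * x ^ 3 - g2 * x - g3" by (simp only: of_real_eq_iff)
  have "of_real (12 * x * - (y ^ 2)) = (of_real ((6 * x ^ 2 - g2 / 2) ^ 2) :: complex)"
    using three_division_relation second_order_differential_equation[OF nL]
    by (simp add: wp_z inv power_mult_distrib flip: z_def)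
  then have td: "12 * x * - (y ^ 2) = (6 * x ^ 2 - g2 / 2) ^ 2" by (simp only: of_real_eq_iff)
  note v = three_division_value[OF m de[unfolded g2_def g3_def] td[unfolded g2_def]]
  have "is_pole (\<lambda>u. 1 - of_real (4 / 9 * k\<^sup>2) * inverse (wp u + 1 / 3)) z"
  proof (rule is_pole_inverse_simple_zero)
    show "((\<lambda>u. wp u + 1 / 3) has_field_derivative \<i> * of_real y) (at z)"
      using wp_derivs(1)[OF nL] by (auto intro!: derivative_eq_intros simp: wp_z)
  qed (use v assms(1) in \<open>simp_all add: wp_z\<close>)
  then show ?thesis by (simp add: w1_def w2_def z)
qed

end
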